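(* The space $\tilde{\mathbb{I}}$ with the order topology induced by the linear order $<_{\mathrm{XY}}$ is not separable.
   Context: $\tilde{\mathbb{I}}=\{\langle\mu,\nu\rangle\in[0,1]^2 \mid \mu+\nu\le 1\}$ is the set of intuitionistic fuzzy values. For $\alpha=\langle\mu_\alpha,\nu_\alpha\rangle\in\tilde{\mathbb{I}}$ put $s(\alpha)=\mu_\alpha-\nu_\alpha$ and $h(\alpha)=\mu_\alpha+\nu_\alpha$. Define $\alpha<_{\mathrm{XY}}\beta$ iff $s(\alpha)<s(\beta)$, or $s(\alpha)=s(\beta)$ and $h(\alpha)<h(\beta)$. The order topology on a linearly ordered set $X$ has as a basis all intervals $(a,b)$, $(\leftarrow,b)=\{x: x<b\}$ and $(a,\rightarrow)=\{x: a<x\}$. Separable means having a countable dense subset. *)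

theory Defs
  imports "HOL-Analysis.Analysis"
begin

typedef ifv = "{(\<mu> :: real, \<nu> :: real). \<mu> \<in> {0..1} \<and> \<nu> \<in> {0..1} \<and> \<mu> + \<nu> \<le> 1}"
  morphisms pair_of_ifv ifv_of_pair
  by (intro exI[of _ "(0, 0)"]) simp

definition membership :: "ifv \<Rightarrow> real" where
  "membership \<alpha> = fst (pair_of_ifv \<alpha>)"

definition nonmembership :: "ifv \<Rightarrow> real" where
  "nonmembership \<alpha> = snd (pair_of_ifv \<alpha>)"

definition score :: "ifv \<Rightarrow> real" where
  "score \<alpha> = membership \<alpha> - nonmembership \<alpha>"

definition accuracy :: "ifv \<Rightarrow> real" where
  "accuracy \<alpha> = membership \<alpha> + nonmembership \<alpha>"

definition less_XY :: "ifv \<Rightarrow> ifv \<Rightarrow> bool" where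
  "less_XY \<alpha> \<beta> \<longleftrightarrow>
     score \<alpha> < score \<beta> \<or> score \<alpha> = score \<beta> \<and> accuracy \<alpha> < accuracy \<beta>"

lemma ifv_eqI:
  assumes "score \<alpha> = score \<beta>" "accuracy \<alpha> = accuracy \<beta>"
  shows "\<alpha> = \<beta>"
proof -
  have "pair_of_ifv \<alpha> = pair_of_ifv \<beta>"
    using assms
    by (simp add: score_def accuracy_def membership_def nonmembership_def prod_eq_iff)
  then show ?thesis
    by (simp add: pair_of_ifv_inject)
qed

instantiation ifv :: linorder
begin

definition less_ifv :: "ifv \<Rightarrow> ifv \<Rightarrow> bool" where
  "less_ifv = less_XY"

definition less_eq_ifv :: "ifv \<Rightarrow> ifv \<Rightarrow> bool" where
  "less_eq_ifv \<alpha> \<beta> \<longleftrightarrow> \<alpha> = \<beta> \<or> less_XY \<alpha> \<beta>"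

instance
proof
  fix \<alpha> \<beta> \<gamma> :: ifv
  show "\<alpha> < \<beta> \<longleftrightarrow> \<alpha> \<le> \<beta> \<and> \<not> \<beta> \<le> \<alpha>"
    by (auto simp: less_ifv_def less_eq_ifv_def less_XY_def)
  show "\<alpha> \<le> \<alpha>"
    by (simp add: less_eq_ifv_def)
  show "\<alpha> \<le> \<gamma>" if "\<alpha> \<le> \<beta>" "\<beta> \<le> \<gamma>"
    using that by (auto simp: less_eq_ifv_def less_XY_def)
  show "\<alpha> = \<beta>" if "\<alpha> \<le> \<beta>" "\<beta> \<le> \<alpha>"
    using that by (auto simp: less_eq_ifv_def less_XY_def)
  show "\<alpha> \<le> \<beta> \<or> \<beta> \<le> \<alpha>"
    using ifv_eqI[of \<alpha> \<beta>] unfolding less_eq_ifv_def less_XY_def by linarith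
qed

end

instantiation ifv :: linorder_topology
begin

definition open_ifv :: "ifv set \<Rightarrow> bool" where
  "open_ifv = generate_topology (range lessThan \<union> range greaterThan)"

instance
  by standard (rule open_ifv_def)

end

text \<open>
  The class \<open>linorder_topology\<close> takes the open rays as a subbase. The next lemma confirms
  that the open intervals and open rays form a base of this topology.
\<close>

lemma topological_basis_ifv:
  "topological_basis
     (range (\<lambda>(\<alpha>, \<beta>). {\<alpha><..<\<beta>}) \<union> range lessThan \<union> range greaterThan :: ifv set set)"
proof (rule topological_basisI)
  fix U :: "ifv set" and x :: ifv
  let ?B = "range (\<lambda>(\<alpha>, \<beta>). {\<alpha><..<\<beta>}) \<union> range lessThan \<union> range greaterThan :: ifv set set"
  assume "open U" "x \<in> U"
  have int: "{a<..<b} \<in> ?B" for a b :: ifv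
    by (auto intro: image_eqI[of _ _ "(a, b)"])
  define p where "p = ifv_of_pair (0, 1)"
  define q where "q = ifv_of_pair (1, 0)"
  have "score p = -1" "score q = 1"
    by (simp_all add: p_def q_def score_def membership_def nonmembership_def ifv_of_pair_inverse)
  then have "p < q"
    by (simp add: less_ifv_def less_XY_def)
  show "\<exists>V\<in>?B. x \<in> V \<and> V \<subseteq> U"
  proof (cases "\<exists>a. a < x")
    case True
    then obtain a where "a < x" by blast
    then obtain b where b: "b < x" "{b<..x} \<subseteq> U"
      using open_left[OF \<open>open U\<close> \<open>x \<in> U\<close>] by blast
    show ?thesis
    proof (cases "\<exists>c. x < c")
      case True
      then obtain c where "x < c" by blast
      then obtain d where d: "x < d" "{x..<d} \<subseteq> U"
        using open_right[OF \<open>open U\<close> \<open>x \<in> U\<close>] by blast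
      have "{b<..<d} \<subseteq> {b<..x} \<union> {x..<d}" by auto
      then show ?thesis
        using b d int[of b d] by (intro bexI[of _ "{b<..<d}"]) auto
    next
      case False
      then have "{b<..} \<subseteq> {b<..x}" by (auto simp: not_less)
      then show ?thesis
        using b by (intro bexI[of _ "{b<..}"]) auto
    qed
  next
    case False
    then have min: "x \<le> y" for y by (auto simp: not_less)
    have "x < q"
      using min[of p] \<open>p < q\<close> by order
    then obtain d where d: "x < d" "{x..<d} \<subseteq> U"
      using open_right[OF \<open>open U\<close> \<open>x \<in> U\<close>] by blast
    have "{..<d} \<subseteq> {x..<d}" using min by auto
    then show ?thesis
      using d by (intro bexI[of _ "{..<d}"]) auto
  qed
qed auto

text \<open>
  Here \<open>euclidean\<close> is the topology given by \<open>open\<close> on \<^typ>\<open>ifv\<close>, which is the order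
  topology, not the topology inherited from the plane.
\<close>

definition XY_order_topology :: "ifv topology" where
  "XY_order_topology = euclidean"

end

(*
  Every score in the open interval from 0 to 1 has a fibre containing a nonempty open interval of
  the lexicographic order. A dense set meets all these pairwise disjoint intervals, so it is
  uncountable.
*)
theory Submission
  imports Defs
begin

text \<open>Solve \<open>\<mu> - \<nu> = s\<close>, \<open>\<mu> + \<nu> = h\<close>: the bound on
  \<open>\<bar>s\<bar>\<close> makes both coordinates nonnegative, and \<open>h \<le> 1\<close>
  bounds their sum, hence each of them.\<close>

lemma ex_ifv_score_accuracy:
  assumes "\<bar>s\<bar> \<le> h" "h \<le> 1"
  obtains \<alpha> where "score \<alpha> = s" "accuracy \<alpha> = h"
proof
  let ?\<alpha> = "ifv_of_pair ((h + s) / 2, (h - s) / 2)"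
  have "pair_of_ifv ?\<alpha> = ((h + s) / 2, (h - s) / 2)"
    using assms by (intro ifv_of_pair_inverse) (auto simp: field_simps)
  then show "score ?\<alpha> = s" "accuracy ?\<alpha> = h"
    by (auto simp: score_def accuracy_def membership_def nonmembership_def field_simps)
qed

text \<open>On the fibre over \<open>s\<close> the accuracy takes every value from
  \<open>\<bar>s\<bar>\<close> to 1, a nondegenerate range; \<open>\<alpha>\<close> and
  \<open>\<beta>\<close> realise its two ends.\<close>

lemma ex_open_interval_in_score_fibre:
  assumes "\<bar>s\<bar> < 1"
  obtains \<alpha> \<beta> where "{\<alpha><..<\<beta>} \<noteq> {}" "{\<alpha><..<\<beta>} \<subseteq> score -` {s}"
proof -
  obtain \<alpha> where \<alpha>: "score \<alpha> = s" "accuracy \<alpha> = \<bar>s\<bar>"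
    using assms by (auto intro: ex_ifv_score_accuracy[of s "\<bar>s\<bar>"])
  obtain \<beta> where \<beta>: "score \<beta> = s" "accuracy \<beta> = 1"
    using assms by (auto intro: ex_ifv_score_accuracy[of s 1])
  \<comment> \<open>The midpoint of the two accuracies puts \<open>\<gamma>\<close> strictly between
    \<open>\<alpha>\<close> and \<open>\<beta>\<close>.\<close>
  obtain \<gamma> where \<gamma>: "score \<gamma> = s" "accuracy \<gamma> = (\<bar>s\<bar> + 1) / 2"
    using assms by (auto intro: ex_ifv_score_accuracy[of s "(\<bar>s\<bar> + 1) / 2"])
  have "\<gamma> \<in> {\<alpha><..<\<beta>}"
    using assms \<alpha> \<beta> \<gamma> by (simp add: less_ifv_def less_XY_def)
  \<comment> \<open>Score is compared first, so anything between two points of score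
    \<open>s\<close> has score \<open>s\<close>.\<close>
  moreover have "{\<alpha><..<\<beta>} \<subseteq> score -` {s}"
    using \<alpha> \<beta> by (auto simp: less_ifv_def less_XY_def)
  ultimately show ?thesis
    using that by blast
qed

theorem proposition5p3:
  shows "\<not> separable_space XY_order_topology"
proof
  assume "separable_space XY_order_topology"
  then obtain D :: "ifv set" where D: "countable D" "closure D = UNIV"
    by (auto simp: separable_space_def XY_order_topology_def)
  have "{0<..<1} \<subseteq> score ` D"
  proof
    fix s :: real
    assume "s \<in> {0<..<1}"
    then obtain \<alpha> \<beta> where I: "{\<alpha><..<\<beta>} \<noteq> {}" "{\<alpha><..<\<beta>} \<subseteq> score -` {s}"
      using ex_open_interval_in_score_fibre[of s] by auto
    \<comment> \<open>An open set disjoint from \<open>D\<close> is disjoint from its closure, which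
      is the whole space.\<close>
    have "{\<alpha><..<\<beta>} \<inter> D \<noteq> {}"
      using I(1) D(2) open_Int_closure_eq_empty[of "{\<alpha><..<\<beta>}" D] by simp
    then show "s \<in> score ` D"
      using I(2) by auto
  qed
  then have "countable {0<..<1::real}"
    using D(1) countable_subset by blast
  then show False
    using uncountable_open_interval[of 0 1] by simp
qed

end
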